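(* Let $f$ be defined on $[0,+\infty)$ by $f(x)=\dfrac{1}{1+2\lfloor x\rfloor-x}$. Then the sequence $(s_n)_{n\geqslant 0}$ satisfies $s_0=0$ and, for every integer $n\geqslant 1$, $$s_n=\frac{1}{3\,(1+2\lfloor s_{n-1}\rfloor-s_{n-1})}=\frac{f(s_{n-1})}{3}.$$
   Context: $\lfloor x\rfloor$ denotes the integral part of $x$. Define triples of integers $N_n=(a_n;b_n;c_n)$ for every integer $n\geqslant 1$ as the labels of the vertices of a quinary tree $\mathcal{A}_5$ read from the top and, at each level, from left to right. The top is $N_1=(1;3;0)$. For every $n\geqslant 1$, the first, second, third, fourth and fifth children of $N_n=(a;b;c)$ are respectively $N_{5n-3}$, $N_{5n-2}$, $N_{5n-1}$, $N_{5n}$, $N_{5n+1}$, and they are given by: - if $3\nmid b$: $N_{5n-3}=(3(4c+3)a-2b;\,3(6c+5)a-3b;\,0)$, $N_{5n-2}=((6c+5)a-b;\,6(c+1)a-b;\,0)$, $N_{5n-1}=(6(c+1)a-b;\,3a;\,0)$, $N_{5n}=(a;\,3a+b;\,c+1)$, $N_{5n+1}=(3a+b;\,6a+3b;\,0)$; - if $3\mid b$: $N_{5n-3}=((4c+3)a-\frac{2b}{3};\,(6c+5)a-b;\,0)$, $N_{5n-2}=((6c+5)a-b;\,6(c+1)a-b;\,0)$, $N_{5n-1}=(2(c+1)a-\frac{b}{3};\,a;\,0)$, $N_{5n}=(a;\,3a+b;\,c+1)$, $N_{5n+1}=(a+\frac{b}{3};\,2a+b;\,0)$. The sequence $(s_n)_{n\geqslant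 0}$ is defined by $s_0=0$ and $s_n=\frac{a_n}{b_n}$ for every $n\geqslant 1$. *)

theory Defs
  imports Complex_Main
begin

(* All divisions by 3 in this function are exact: they occur only when 3 divides b.
   Children are counted from the left, starting at 0. *)
definition child :: "nat \<Rightarrow> int \<times> int \<times> int \<Rightarrow> int \<times> int \<times> int" where
  "child i = (\<lambda>(a, b, c).
     if \<not> 3 dvd b then
       [(3 * (4 * c + 3) * a - 2 * b, 3 * (6 * c + 5) * a - 3 * b, 0),
        ((6 * c + 5) * a - b, 6 * (c + 1) * a - b, 0),
        (6 * (c + 1) * a - b, 3 * a, 0),
        (a, 3 * a + b, c + 1),
        (3 * a + b, 6 * a + 3 * b, 0)] ! i
     else
       [((4 * c + 3) * a - (2 * b) div 3, (6 * c + 5) * a - b, 0),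
        ((6 * c + 5) * a - b, 6 * (c + 1) * a - b, 0),
        (2 * (c + 1) * a - b div 3, a, 0),
        (a, 3 * a + b, c + 1),
        (a + b div 3, 2 * a + b, 0)] ! i)"

(* In breadth-first order the vertices 5 n - 3, ..., 5 n + 1 are the children of
   vertex n, so vertex m >= 2 is child number (m + 3) mod 5 of vertex (m + 3) div 5.
   Vertices are numbered from 1; the value at 0 is a dummy. *)
fun N :: "nat \<Rightarrow> int \<times> int \<times> int" where
  "N m = (if m \<le> 1 then (1, 3, 0) else child ((m + 3) mod 5) (N ((m + 3) div 5)))"

declare N.simps [simp del]

lemma N_top: "N 1 = (1, 3, 0)"
  by (simp add: N.simps)

lemma N_children:
  assumes "n \<ge> 1"
  shows "N (5 * n - 3) = child 0 (N n)"
    and "N (5 * n - 2) = child 1 (N n)"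
    and "N (5 * n - 1) = child 2 (N n)"
    and "N (5 * n) = child 3 (N n)"
    and "N (5 * n + 1) = child 4 (N n)"
proof -
  have step: "N m = child i (N n)" if "m \<ge> 2" "m + 3 = 5 * n + i" "i < 5" for m i
    using that by (subst N.simps) simp
  show "N (5 * n - 3) = child 0 (N n)" using assms by (intro step) auto
  show "N (5 * n - 2) = child 1 (N n)" using assms by (intro step) auto
  show "N (5 * n - 1) = child 2 (N n)" using assms by (intro step) auto
  show "N (5 * n) = child 3 (N n)" using assms by (intro step) auto
  show "N (5 * n + 1) = child 4 (N n)" using assms by (intro step) auto
qed

definition s :: "nat \<Rightarrow> real" where
  "s n = (if n = 0 then 0
          else case N n of (a, b, c) \<Rightarrow> real_of_int a / real_of_int b)"

end

theory Submission
  imports Defs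
begin

text \<open>
  For a vertex \<open>(a, b, c)\<close> with quotient \<open>x = a / b\<close>, put \<open>t = b / (3 * a)\<close>, so that
  \<open>x = 1 / (3 * t)\<close>. Throughout the tree \<open>c\<close> is the integer with \<open>c < t \<le> c + 1\<close>
  (\<open>admissible\<close>, which passes to children by \<open>admissible_child\<close>), and, whether or not
  \<open>3\<close> divides \<open>b\<close>, the children have the quotients
  \<open>(4c + 3 - 2t) / (6c + 5 - 3t)\<close>, \<open>(6c + 5 - 3t) / (6c + 6 - 3t)\<close>, \<open>2c + 2 - t\<close>,
  \<open>1 / (3t + 3)\<close> and \<open>(t + 1) / (3t + 2)\<close>.

  Write \<open>G\<close> for \<open>next_value\<close>, that is, \<open>G x = 1 / (3 * (1 + 2 * \<lfloor>x\<rfloor> - x))\<close>. All of these quotients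
  except the third lie in \<open>[0, 1)\<close>, where \<open>G x = 1 / (3 * (1 - x))\<close>, and the third has integral part
  \<open>c + 1\<close>; hence \<open>G\<close> sends each of the first four children to its right
  neighbour (\<open>next_value_siblings\<close>).

  There remains the passage from the last child of a vertex \<open>k\<close> to the first child of
  vertex \<open>k + 1\<close>, which goes by induction. If \<open>s (k + 1) = G (s k)\<close>, then
  \<open>t = 1 + 2 * \<lfloor>s k\<rfloor> - s k\<close> at vertex \<open>k + 1\<close>, so \<open>c = \<lfloor>s k\<rfloor>\<close> there and the
  first child of \<open>k + 1\<close> has the quotient \<open>(2 * s k + 1) / (3 * s k + 2)\<close>. That is
  \<open>G\<close> of the quotient \<open>(3 * s k + 1) / (6 * s k + 3)\<close> of the last child of \<open>k\<close>
  (\<open>next_value_across_parents\<close>).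
\<close>

definition ratio :: "int \<times> int \<times> int \<Rightarrow> real" where
  "ratio v = (case v of (a, b, c) \<Rightarrow> real_of_int a / real_of_int b)"

text \<open>The last two conditions say that \<open>c < b / (3 * a) \<le> c + 1\<close>.\<close>

definition admissible :: "int \<times> int \<times> int \<Rightarrow> bool" where
  "admissible v = (case v of (a, b, c) \<Rightarrow>
     0 < a \<and> 0 < b \<and> 0 \<le> c \<and> 3 * (a * c) < b \<and> b \<le> 3 * (a * c) + 3 * a)"

definition next_value :: "real \<Rightarrow> real" where
  "next_value x = 1 / (3 * (1 + 2 * real_of_int \<lfloor>x\<rfloor> - x))"

lemma next_value_unit_interval:
  assumes "0 \<le> x" "x < 1"
  shows "next_value x = 1 / (3 * (1 - x))"
proof -
  have "\<lfloor>x\<rfloor> = 0" using assms by (simp add: floor_eq_iff)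
  then show ?thesis by (simp add: next_value_def)
qed

lemma less_5_cases:
  fixes i :: nat
  assumes "i < 5"
  obtains "i = 0" | "i = 1" | "i = 2" | "i = 3" | "i = 4"
  using assms by linarith

text \<open>After \<open>a * c\<close> is treated as a single nonnegative unknown, every condition on a child is
  linear in \<open>a\<close>, \<open>b\<close> and \<open>a * c\<close>.\<close>

lemma admissible_child:
  assumes "admissible v" "i < 5"
  shows "admissible (child i v)"
proof -
  obtain a b c where v: "v = (a, b, c)" by (cases v)
  have h: "0 < a" "0 < b" "0 \<le> c" "3 * (a * c) < b" "b \<le> 3 * (a * c) + 3 * a"
    using assms(1) by (auto simp: admissible_def v)
  then have "0 \<le> a * c" by simp
  note h = h this
  show ?thesis
  proof (cases "3 dvd b")
    case True
    then obtain k where k: "b = 3 * k" by auto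
    have b: "(3 * k) div 3 = k" "(2 * (3 * k)) div 3 = 2 * k" by simp_all
    from \<open>i < 5\<close> show ?thesis unfolding k v
      by (cases rule: less_5_cases; simp add: b admissible_def child_def algebra_simps;
          (intro conjI)?; use h k in linarith)
  next
    case False
    from \<open>i < 5\<close> show ?thesis unfolding v
      by (cases rule: less_5_cases; simp add: False admissible_def child_def algebra_simps;
          (intro conjI)?; use h in linarith)
  qed
qed

lemma admissible_N: "admissible (N m)"
proof (induction m rule: N.induct)
  case (1 m)
  show ?case
  proof (cases "m \<le> 1")
    case True
    then show ?thesis by (simp add: N.simps admissible_def)
  next
    case False
    then show ?thesis using 1 admissible_child by (subst N.simps) simp
  qed
qed

text \<open>The two forms of each child differ at most by a common factor \<open>3\<close>, which cancels in the
  quotient, as does the factor \<open>a\<close> that remains after \<open>b = 3 * a * t\<close> is substituted.\<close>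

lemma ratio_child:
  assumes "admissible (a, b, c)"
  defines "t \<equiv> real_of_int b / (3 * real_of_int a)" and "C \<equiv> real_of_int c"
  shows "ratio (child 0 (a, b, c)) = (4 * C + 3 - 2 * t) / (6 * C + 5 - 3 * t)"
    and "ratio (child 1 (a, b, c)) = (6 * C + 5 - 3 * t) / (6 * C + 6 - 3 * t)"
    and "ratio (child 2 (a, b, c)) = 2 * C + 2 - t"
    and "ratio (child 3 (a, b, c)) = 1 / (3 * t + 3)"
    and "ratio (child 4 (a, b, c)) = (t + 1) / (3 * t + 2)"
proof -
  define r where "r = real_of_int a"
  have r: "r \<noteq> 0" using assms(1) by (simp add: admissible_def r_def)
  have b: "real_of_int b = 3 * r * t" using r by (simp add: t_def r_def)
  have ratio: "ratio (u, w, d) = x / y"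
    if "real_of_int u = k * x" "real_of_int w = k * y" "k \<noteq> 0" for u w d x y k
    using that by (simp add: ratio_def)
  note eqs = b r r_def[symmetric] C_def[symmetric] algebra_simps
  have "ratio (child 0 (a, b, c)) = (4 * C + 3 - 2 * t) / (6 * C + 5 - 3 * t) \<and>
    ratio (child 1 (a, b, c)) = (6 * C + 5 - 3 * t) / (6 * C + 6 - 3 * t) \<and>
    ratio (child 2 (a, b, c)) = (2 * C + 2 - t) / 1 \<and>
    ratio (child 3 (a, b, c)) = 1 / (3 * t + 3) \<and>
    ratio (child 4 (a, b, c)) = (t + 1) / (3 * t + 2)"
  proof (cases "3 dvd b")
    case True
    then obtain k where k: "b = 3 * k" by auto
    have rk: "real_of_int k = r * t" using b k by simp
    have "child 0 (a, b, c) = ((4 * c + 3) * a - 2 * k, (6 * c + 5) * a - 3 * k, 0)"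
      "child 1 (a, b, c) = ((6 * c + 5) * a - 3 * k, 6 * (c + 1) * a - 3 * k, 0)"
      "child 2 (a, b, c) = (2 * (c + 1) * a - k, a, 0)"
      "child 3 (a, b, c) = (a, 3 * a + 3 * k, c + 1)"
      "child 4 (a, b, c) = (a + k, 2 * a + 3 * k, 0)"
      by (simp_all add: child_def k)
    then show ?thesis
      by (simp only:, intro conjI ratio[where k = r]) (simp_all add: eqs rk)
  next
    case False
    have children:
      "child 0 (a, b, c) = (3 * (4 * c + 3) * a - 2 * b, 3 * (6 * c + 5) * a - 3 * b, 0)"
      "child 1 (a, b, c) = ((6 * c + 5) * a - b, 6 * (c + 1) * a - b, 0)"
      "child 2 (a, b, c) = (6 * (c + 1) * a - b, 3 * a, 0)"
      "child 3 (a, b, c) = (a, 3 * a + b, c + 1)"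
      "child 4 (a, b, c) = (3 * a + b, 6 * a + 3 * b, 0)"
      by (simp_all add: child_def False)
    show ?thesis
    proof (intro conjI)
      show "ratio (child 0 (a, b, c)) = (4 * C + 3 - 2 * t) / (6 * C + 5 - 3 * t)"
        unfolding children by (intro ratio[where k = "3 * r"]) (simp_all add: eqs)
      show "ratio (child 1 (a, b, c)) = (6 * C + 5 - 3 * t) / (6 * C + 6 - 3 * t)"
        unfolding children by (intro ratio[where k = r]) (simp_all add: eqs)
      show "ratio (child 2 (a, b, c)) = (2 * C + 2 - t) / 1"
        unfolding children by (intro ratio[where k = "3 * r"]) (simp_all add: eqs)
      show "ratio (child 3 (a, b, c)) = 1 / (3 * t + 3)"
        unfolding children by (intro ratio[where k = r]) (simp_all add: eqs)
      show "ratio (child 4 (a, b, c)) = (t + 1) / (3 * t + 2)"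
        unfolding children by (intro ratio[where k = "3 * r"]) (simp_all add: eqs)
    qed
  qed
  then show "ratio (child 0 (a, b, c)) = (4 * C + 3 - 2 * t) / (6 * C + 5 - 3 * t)"
    and "ratio (child 1 (a, b, c)) = (6 * C + 5 - 3 * t) / (6 * C + 6 - 3 * t)"
    and "ratio (child 2 (a, b, c)) = 2 * C + 2 - t"
    and "ratio (child 3 (a, b, c)) = 1 / (3 * t + 3)"
    and "ratio (child 4 (a, b, c)) = (t + 1) / (3 * t + 2)"
    by simp_all
qed

lemma admissible_bounds:
  assumes "admissible (a, b, c)"
  defines "t \<equiv> real_of_int b / (3 * real_of_int a)" and "C \<equiv> real_of_int c"
  shows "0 \<le> C" "C < t" "t \<le> C + 1" "ratio (a, b, c) = 1 / (3 * t)"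
proof -
  have a: "0 < real_of_int a" and c: "0 \<le> c"
    and "3 * (a * c) < b" "b \<le> 3 * (a * c) + 3 * a"
    using assms(1) by (simp_all add: admissible_def)
  then have "real_of_int (3 * (a * c)) < real_of_int b"
    "real_of_int b \<le> real_of_int (3 * (a * c) + 3 * a)"
    by (simp_all only: of_int_less_iff of_int_le_iff)
  with a show "C < t" "t \<le> C + 1"
    by (simp_all add: t_def C_def field_simps)
  show "0 \<le> C" using c by (simp add: C_def)
  show "ratio (a, b, c) = 1 / (3 * t)" using a by (simp add: ratio_def t_def)
qed

lemma next_value_siblings:
  assumes "admissible v" "i < 4"
  shows "next_value (ratio (child i v)) = ratio (child (Suc i) v)"
proof -
  obtain a b c where v: "v = (a, b, c)" by (cases v)
  define t C where "t = real_of_int b / (3 * real_of_int a)" and "C = real_of_int c"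
  note q = ratio_child[OF assms(1)[unfolded v], folded t_def C_def v]
  have c: "0 \<le> C" "C < t" "t \<le> C + 1"
    using admissible_bounds[OF assms(1)[unfolded v]] by (simp_all add: t_def C_def)
  consider "i = 0" | "i = 1" | "i = 2" | "i = 3" using \<open>i < 4\<close> by linarith
  then show ?thesis
  proof cases
    case 1
    have "0 < 6 * C + 5 - 3 * t" "0 < 2 * C + 2 - t" using c by linarith+
    then have "1 - ratio (child 0 v) = (2 * C + 2 - t) / (6 * C + 5 - 3 * t)"
      unfolding q by (simp add: field_simps)
    moreover have "next_value (ratio (child 0 v)) = 1 / (3 * (1 - ratio (child 0 v)))"
      unfolding q using c by (intro next_value_unit_interval) simp_all
    ultimately have "next_value (ratio (child 0 v)) =
        1 / (3 * ((2 * C + 2 - t) / (6 * C + 5 - 3 * t)))"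
      by (simp only:)
    then show ?thesis using q(2) 1 by (simp add: algebra_simps)
  next
    case 2
    have "0 < 6 * C + 6 - 3 * t" using c by linarith
    then have "1 - ratio (child 1 v) = 1 / (6 * C + 6 - 3 * t)"
      unfolding q by (simp add: field_simps)
    moreover have "next_value (ratio (child 1 v)) = 1 / (3 * (1 - ratio (child 1 v)))"
      unfolding q using c by (intro next_value_unit_interval) simp_all
    ultimately show ?thesis using q(3) 2 by (simp add: numeral_2_eq_2[symmetric])
  next
    case 3
    have "\<lfloor>2 * C + 2 - t\<rfloor> = c + 1" using c by (simp add: floor_eq_iff C_def)
    then have "next_value (ratio (child 2 v)) = ratio (child 3 v)"
      unfolding q by (simp add: next_value_def C_def algebra_simps)
    then show ?thesis using 3 by (simp add: numeral_3_eq_3)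
  next
    case 4
    have "0 < t" using c by linarith
    then have "1 - ratio (child 3 v) = (3 * t + 2) / (3 * t + 3)"
      unfolding q by (simp add: field_simps)
    moreover have "next_value (ratio (child 3 v)) = 1 / (3 * (1 - ratio (child 3 v)))"
      unfolding q using \<open>0 < t\<close> by (intro next_value_unit_interval) simp_all
    ultimately have "next_value (ratio (child 3 v)) = 1 / (3 * ((3 * t + 2) / (3 * t + 3)))"
      by (simp only:)
    also have "\<dots> = ratio (child 4 v)"
      unfolding q using \<open>0 < t\<close> by (simp add: divide_simps) (simp add: algebra_simps)
    finally show ?thesis using 4 by simp
  qed
qed

lemma s_eq_ratio: "n \<ge> 1 \<Longrightarrow> s n = ratio (N n)"
  by (simp add: s_def ratio_def)

lemma s_nonneg: "0 \<le> s n"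
  using admissible_N[of n] by (auto simp: s_def admissible_def split: prod.splits)

text \<open>The case \<open>k = 0\<close> holds too: the top of the tree behaves as the last child of a virtual
  vertex \<open>0\<close> with quotient \<open>s 0 = 0\<close>. The induction can therefore start from \<open>s 0\<close>.\<close>

lemma s_last_child: "s (5 * k + 1) = (3 * s k + 1) / (6 * s k + 3)"
proof (cases "k = 0")
  case True
  then show ?thesis using N_top by (simp add: s_def)
next
  case False
  obtain a b c where N: "N k = (a, b, c)" by (cases "N k")
  define t where "t = real_of_int b / (3 * real_of_int a)"
  have adm: "admissible (a, b, c)" using admissible_N[of k] N by simp
  have "0 < t" using admissible_bounds[OF adm] by (simp add: t_def)
  have sk: "s k = 1 / (3 * t)"
    using admissible_bounds(4)[OF adm] False N by (simp add: s_eq_ratio t_def)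
  have "s (5 * k + 1) = (t + 1) / (3 * t + 2)"
    using ratio_child(5)[OF adm] N_children(5)[of k] False N
    by (simp add: s_eq_ratio t_def)
  also have "\<dots> = (3 * s k + 1) / (6 * s k + 3)"
    unfolding sk using \<open>0 < t\<close> by (simp add: divide_simps) (simp add: algebra_simps)
  finally show ?thesis .
qed

lemma next_value_across_parents:
  assumes step: "s (Suc k) = next_value (s k)"
  shows "next_value (s (5 * k + 1)) = s (5 * k + 2)"
proof -
  define x where "x = s k"
  have x: "0 \<le> x" by (simp add: x_def s_nonneg)
  obtain a b c where N: "N (Suc k) = (a, b, c)" by (cases "N (Suc k)")
  define t where "t = real_of_int b / (3 * real_of_int a)"
  have adm: "admissible (a, b, c)" using admissible_N[of "Suc k"] N by simp
  note bnd = admissible_bounds[OF adm, folded t_def]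
  have "1 / (3 * t) = 1 / (3 * (1 + 2 * real_of_int \<lfloor>x\<rfloor> - x))"
    using step bnd(4) N by (simp add: s_eq_ratio next_value_def x_def)
  then have t: "t = 1 + 2 * real_of_int \<lfloor>x\<rfloor> - x" by simp
  \<comment> \<open>Here \<open>t = \<lfloor>x\<rfloor> + 1 - (x - \<lfloor>x\<rfloor>)\<close> lies in \<open>(\<lfloor>x\<rfloor>, \<lfloor>x\<rfloor> + 1]\<close>, and \<open>(c, c + 1]\<close> is
    the only such interval that contains \<open>t\<close>.\<close>
  have c: "c = \<lfloor>x\<rfloor>"
    using bnd(2,3) of_int_floor_le[of x] real_of_int_floor_add_one_gt[of x] t by linarith
  have "s (5 * k + 2) = ratio (child 0 (N (Suc k)))"
    using N_children(1)[of "Suc k"] by (simp add: s_eq_ratio)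
  also have "\<dots> = (4 * c + 3 - 2 * t) / (6 * c + 5 - 3 * t)"
    using ratio_child(1)[OF adm] N by (simp add: t_def)
  also have "\<dots> = (2 * x + 1) / (3 * x + 2)"
    unfolding t c by (simp add: algebra_simps)
  also have "\<dots> = 1 / (3 * (1 - (3 * x + 1) / (6 * x + 3)))"
    using x by (simp add: field_simps)
  also have "\<dots> = next_value ((3 * x + 1) / (6 * x + 3))"
    using x by (intro next_value_unit_interval[symmetric]) (auto simp: field_simps)
  finally show ?thesis by (simp only: s_last_child x_def)
qed

lemma s_Suc: "s (Suc n) = next_value (s n)"
proof (induction n rule: less_induct)
  case (less n)
  show ?case
  proof (cases "n = 0")
    case True
    then show ?thesis using N_top by (simp add: s_def next_value_def)
  next
    case False
    \<comment> \<open>Vertex \<open>n\<close> is child \<open>i\<close> of vertex \<open>k\<close>; in particular \<open>n = 1\<close> gives \<open>k = 0\<close> and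
      \<open>i = 4\<close>, and the top counts as the last child of the virtual vertex \<open>0\<close>.\<close>
    define k i where "k = (n + 3) div 5" and "i = (n + 3) mod 5"
    have n: "n + 3 = 5 * k + i" "i < 5" by (simp_all add: k_def i_def)
    show ?thesis
    proof (cases "i = 4")
      case True
      then have "n = 5 * k + 1" using n by simp
      moreover have "s (Suc k) = next_value (s k)"
        using less.IH[of k] \<open>n = 5 * k + 1\<close> by simp
      ultimately show ?thesis using next_value_across_parents[of k] by simp
    next
      case False
      then have i: "i < 4" using n(2) by simp
      have "1 \<le> k" using i n(1) \<open>n \<noteq> 0\<close> by (cases k) auto
      have "1 < n" using i n(1) \<open>1 \<le> k\<close> by linarith
      moreover have "(Suc n + 3) div 5 = k" "(Suc n + 3) mod 5 = Suc i"
      proof -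
        have eq: "Suc n + 3 = Suc i + k * 5" using n(1) by simp
        show "(Suc n + 3) div 5 = k" "(Suc n + 3) mod 5 = Suc i"
          unfolding eq using i by (simp_all del: add_Suc)
      qed
      ultimately have "s n = ratio (child i (N k))" "s (Suc n) = ratio (child (Suc i) (N k))"
        by (simp_all add: s_eq_ratio N.simps[of n] N.simps[of "Suc n"]
            flip: k_def i_def)
      then show ?thesis
        using next_value_siblings[OF admissible_N i] by simp
    qed
  qed
qed

theorem corollary6:
  fixes f :: "real \<Rightarrow> real"
  assumes "\<And>x. x \<ge> 0 \<Longrightarrow> f x = 1 / (1 + 2 * real_of_int \<lfloor>x\<rfloor> - x)"
  shows "s 0 = 0 \<and>
    (\<forall>n\<ge>1. s n = 1 / (3 * (1 + 2 * real_of_int \<lfloor>s (n - 1)\<rfloor> - s (n - 1))) \<and>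
           1 / (3 * (1 + 2 * real_of_int \<lfloor>s (n - 1)\<rfloor> - s (n - 1))) = f (s (n - 1)) / 3)"
proof (intro conjI allI impI)
  show "s 0 = 0" by (simp add: s_def)
next
  fix n :: nat
  assume "n \<ge> 1"
  then show "s n = 1 / (3 * (1 + 2 * real_of_int \<lfloor>s (n - 1)\<rfloor> - s (n - 1)))"
    using s_Suc[of "n - 1"] by (simp add: next_value_def)
  show "1 / (3 * (1 + 2 * real_of_int \<lfloor>s (n - 1)\<rfloor> - s (n - 1))) = f (s (n - 1)) / 3"
    by (simp add: assms s_nonneg)
qed

end
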